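(* Let $n\ge 3$ and let $(T,+,\Gamma,\mu)$ be a (possibly non-commutative) $n$-ary $\Gamma$-semiring. An ideal $Q$ of $T$ is $n$-ary semiprime if and only if $Q=\sqrt[n,\Gamma]{Q}$. Moreover, $I\mapsto\sqrt[n,\Gamma]{I}$ is a closure operator on the lattice of ideals of $T$ (ordered by inclusion).
   Context: $\Gamma$ is an additive semigroup and $(T,+)$ a commutative additive semigroup with identity $0$. An $n$-ary $\Gamma$-semiring is $(T,+,\Gamma,\mu)$ with $\mu:T^n\times\Gamma^{n-1}\to T$, written $\mu(x_1,\alpha_1,x_2,\ldots,\alpha_{n-1},x_n)$, additive in each $T$-variable, $0$-absorbing in each $T$-position (the value is $0$ if some $x_i=0$), and $n$-ary associative: any two legal bracketings by $\mu$ of the same word $x_1\alpha_1x_2\alpha_2\cdots x_N$ give the same element. An ideal (two-sided ideal) of $T$ is an $(n,1)$-ideal: a nonempty $I\subseteq T$ closed under $+$ such that $\mu(x_1,\alpha_1,\ldots,\alpha_{n-1},x_n)\in I$ whenever at least one $x_i\in I$. A proper $(n,1)$-ideal $P\subsetneq T$ is $n$-ary prime if $\mu(x_1,\alpha_1,\ldots,\alpha_{n-1},x_n)\in P$ implies $x_i\in P$ for some $i$. A two-sided ideal $Q$ is $n$-ary semiprime if for all $a\in T$ and all $\alpha_1,\dots,\alpha_{n-1}\in\Gamma$, $\mu(a,\alpha_1,a,\alpha_2,\ldots,\alpha_{n-1},a)\in Q$ ($n$ copies of $a$) implies $a\in Q$. The $n$-ary prime radical of an ideal $I$ is $\sqrt[n,\Gamma]{I}=\bigcap\{P\supseteq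 I: P\text{ is } n\text{-ary prime}\}$ (the empty intersection being $T$). *)

theory Defs
  imports "HOL-Algebra.Lattice"
begin

text \<open>
  An operation \<open>\<mu>(x\<^sub>1, \<alpha>\<^sub>1, x\<^sub>2, \<dots>, \<alpha>\<^sub>n\<^sub>-\<^sub>1, x\<^sub>n)\<close> is rendered as \<open>\<mu> xs as\<close> with
  \<open>xs = [x\<^sub>1, \<dots>, x\<^sub>n]\<close> and \<open>as = [\<alpha>\<^sub>1, \<dots>, \<alpha>\<^sub>n\<^sub>-\<^sub>1]\<close>. Its values on lists of other lengths are
  irrelevant: every condition below only refers to argument lists in \<open>nary_args\<close>.
\<close>

definition nary_args :: "nat \<Rightarrow> 't list \<Rightarrow> 'g list \<Rightarrow> bool" where
  "nary_args n xs as \<longleftrightarrow> length xs = n \<and> length as = n - 1"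

text \<open>
  Bracketings are trees whose inner nodes are applications of \<open>\<mu>\<close>. The word read off a tree is
  the alternating sequence \<open>x\<^sub>1 \<alpha>\<^sub>1 x\<^sub>2 \<alpha>\<^sub>2 \<dots> x\<^sub>N\<close>, with \<open>Inl\<close> marking elements of \<open>T\<close> and \<open>Inr\<close>
  elements of \<open>\<Gamma>\<close>; \<open>Bracket ts as\<close> separates the words of consecutive subtrees by the letters
  of \<open>as\<close>.
\<close>

datatype ('t, 'g) bracketing =
    Letter 't
  | Bracket "('t, 'g) bracketing list" "'g list"

fun legal_bracketing :: "nat \<Rightarrow> ('t, 'g) bracketing \<Rightarrow> bool" where
  "legal_bracketing n (Letter x) \<longleftrightarrow> True"
| "legal_bracketing n (Bracket ts as) \<longleftrightarrow>
     nary_args n ts as \<and> (\<forall>t\<in>set ts. legal_bracketing n t)"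

fun bracketing_word :: "('t, 'g) bracketing \<Rightarrow> ('t + 'g) list" where
  "bracketing_word (Letter x) = [Inl x]"
| "bracketing_word (Bracket ts as) =
     (case map bracketing_word ts of
        [] \<Rightarrow> []
      | w # ws \<Rightarrow> w @ concat (map2 (\<lambda>\<alpha> v. Inr \<alpha> # v) as ws))"

fun bracketing_value :: "('t list \<Rightarrow> 'g list \<Rightarrow> 't) \<Rightarrow> ('t, 'g) bracketing \<Rightarrow> 't" where
  "bracketing_value \<mu> (Letter x) = x"
| "bracketing_value \<mu> (Bracket ts as) = \<mu> (map (bracketing_value \<mu>) ts) as"

locale nary_gamma_semiring =
  fixes n :: nat
    and \<mu> :: "'t::comm_monoid_add list \<Rightarrow> 'g::semigroup_add list \<Rightarrow> 't"
  assumes additive: "nary_args n xs as \<Longrightarrow> i < n \<Longrightarrow>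
      \<mu> (xs[i := x + y]) as = \<mu> (xs[i := x]) as + \<mu> (xs[i := y]) as"
    and absorbing: "nary_args n xs as \<Longrightarrow> 0 \<in> set xs \<Longrightarrow> \<mu> xs as = 0"
    and associative: "legal_bracketing n s \<Longrightarrow> legal_bracketing n t \<Longrightarrow>
      bracketing_word s = bracketing_word t \<Longrightarrow> bracketing_value \<mu> s = bracketing_value \<mu> t"

definition nary_ideal ::
  "nat \<Rightarrow> ('t::comm_monoid_add list \<Rightarrow> 'g::semigroup_add list \<Rightarrow> 't) \<Rightarrow> 't set \<Rightarrow> bool" where
  "nary_ideal n \<mu> I \<longleftrightarrow> I \<noteq> {} \<and> (\<forall>x\<in>I. \<forall>y\<in>I. x + y \<in> I) \<and>
     (\<forall>xs as. nary_args n xs as \<longrightarrow> (\<exists>x\<in>set xs. x \<in> I) \<longrightarrow> \<mu> xs as \<in> I)"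

definition nary_prime ::
  "nat \<Rightarrow> ('t::comm_monoid_add list \<Rightarrow> 'g::semigroup_add list \<Rightarrow> 't) \<Rightarrow> 't set \<Rightarrow> bool" where
  "nary_prime n \<mu> P \<longleftrightarrow> nary_ideal n \<mu> P \<and> P \<noteq> UNIV \<and>
     (\<forall>xs as. nary_args n xs as \<longrightarrow> \<mu> xs as \<in> P \<longrightarrow> (\<exists>x\<in>set xs. x \<in> P))"

definition nary_semiprime ::
  "nat \<Rightarrow> ('t::comm_monoid_add list \<Rightarrow> 'g::semigroup_add list \<Rightarrow> 't) \<Rightarrow> 't set \<Rightarrow> bool" where
  "nary_semiprime n \<mu> Q \<longleftrightarrow> nary_ideal n \<mu> Q \<and>
     (\<forall>a as. length as = n - 1 \<longrightarrow> \<mu> (replicate n a) as \<in> Q \<longrightarrow> a \<in> Q)"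

definition nary_radical ::
  "nat \<Rightarrow> ('t::comm_monoid_add list \<Rightarrow> 'g::semigroup_add list \<Rightarrow> 't) \<Rightarrow> 't set \<Rightarrow> 't set" where
  "nary_radical n \<mu> I = \<Inter>{P. nary_prime n \<mu> P \<and> I \<subseteq> P}"

definition ideal_lattice ::
  "nat \<Rightarrow> ('t::comm_monoid_add list \<Rightarrow> 'g::semigroup_add list \<Rightarrow> 't) \<Rightarrow> 't set gorder" where
  "ideal_lattice n \<mu> = \<lparr>carrier = {I. nary_ideal n \<mu> I}, eq = (=), le = (\<subseteq>)\<rparr>"

definition closure_operator :: "('a, 'b) gorder_scheme \<Rightarrow> ('a \<Rightarrow> 'a) \<Rightarrow> bool" where
  "closure_operator L f \<longleftrightarrow> f \<in> carrier L \<rightarrow> carrier L \<and>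
     (\<forall>x\<in>carrier L. x \<sqsubseteq>\<^bsub>L\<^esub> f x) \<and> isotone L L f \<and> idempotent L f"

end

theory Submission
  imports Defs "HOL-Algebra.Complete_Lattice" "HOL-Number_Theory.Cong"
begin

text \<open>
  Let \<open>P\<close> be semiprime. If a word has its value in \<open>P\<close>, then so does every rotation of it: a power
  of the rotated word contains the original word as a factor. Hence whether a word has its value
  in \<open>P\<close> depends only on its set of \<open>T\<close>-letters, and enlarging that set preserves membership.
  Consequently the colon ideals \<open>{y. y u \<in> P}\<close> of \<open>P\<close> are again semiprime.

  Given a semiprime \<open>Q\<close> and \<open>a \<notin> Q\<close>, Zorn's lemma yields a maximal semiprime \<open>P \<supseteq> Q\<close> with \<open>a \<notin> P\<close>.
  If \<open>\<mu>(x\<^sub>1, \<dots>, x\<^sub>n) \<in> P\<close> with no \<open>x\<^sub>i\<close> in \<open>P\<close>, the colon ideal by \<open>x\<^sub>2, \<dots>, x\<^sub>n\<close> properly contains \<open>P\<close>, so it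
  contains \<open>a\<close>, which means that \<open>x\<^sub>1\<close> may be replaced by \<open>a\<close>. Replacing every \<open>x\<^sub>i\<close> in this way gives
  \<open>a \<in> P\<close>, a contradiction; so \<open>P\<close> is prime, and \<open>Q\<close> is the intersection of the primes above it.
\<close>

section \<open>Evaluation of words from the left\<close>

text \<open>The operation \<open>f\<close> is a parameter so that one recursion yields both values
  (\<open>f = \<mu>\<close>) and bracketing trees (\<open>f = Bracket\<close>). A collapsed block
  inherits the separator of its last entry; the guard \<open>n < 2\<close> excludes collapses that
  would not shorten the list.\<close>

function left_fold :: "('a list \<Rightarrow> 'g list \<Rightarrow> 'a) \<Rightarrow> nat \<Rightarrow> ('a \<times> 'g) list \<Rightarrow> 'a" where
  "left_fold f n ps =
     (if length ps < 2 \<or> n < 2 then fst (hd ps)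
      else left_fold f n ((f (map fst (take n ps)) (butlast (map snd (take n ps))),
                           snd (last (take n ps))) # drop n ps))"
  by auto
termination by (relation "measure (\<lambda>(f, n, ps). length ps)") auto

declare left_fold.simps [simp del]

lemma left_fold_single [simp]: "left_fold f n [p] = fst p"
  by (subst left_fold.simps) simp

lemma left_fold_exact:
  assumes "n \<ge> 2" "length ps = n"
  shows "left_fold f n ps = f (map fst ps) (butlast (map snd ps))"
  using assms by (subst left_fold.simps) auto

text \<open>Since \<open>h\<close> commutes with every collapse and separators are untouched, it
  commutes with the fold. With \<open>h = bracketing_value \<mu>\<close> this turns folds of trees
  into folds of values.\<close>

lemma left_fold_hom:
  assumes "\<And>xs as. h (f xs as) = g (map h xs) as" "ps \<noteq> []"
  shows "h (left_fold f n ps) = left_fold g n (map (map_prod h id) ps)"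
  using assms
proof (induction f n ps rule: left_fold.induct)
  case (1 f n ps)
  show ?case
  proof (cases "length ps < 2 \<or> n < 2")
    case True
    with 1 show ?thesis
      by (subst (1 2) left_fold.simps) (auto simp: hd_map)
  next
    case False
    then have ne: "take n ps \<noteq> []" by auto
    have "h (left_fold f n ps) = h (left_fold f n ((f (map fst (take n ps)) (butlast (map snd (take n ps))),
                           snd (last (take n ps))) # drop n ps))"
      using False by (subst left_fold.simps) simp
    also have "\<dots> = left_fold g n (map (map_prod h id) ((f (map fst (take n ps)) (butlast (map snd (take n ps))),
                           snd (last (take n ps))) # drop n ps))"
      using 1 False by blast
    also have "\<dots> = left_fold g n (map (map_prod h id) ps)"
      using False ne 1(2)
      by (subst (2) left_fold.simps) (auto simp: take_map drop_map last_map comp_def)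
    finally show ?thesis .
  qed
qed

text \<open>A collapse inside \<open>ps\<close> does not reach the last separator, and the collapse
  that reaches it removes it from the arguments by \<open>butlast\<close>.\<close>

lemma left_fold_last_letter: "left_fold f n (ps @ [(x, \<alpha>)]) = left_fold f n (ps @ [(x, \<beta>)])"
proof (induction "length ps" arbitrary: ps rule: less_induct)
  case less
  consider "ps = [] \<or> n < 2" | "n \<ge> 2" "ps \<noteq> []" "n \<le> length ps"
    | "n \<ge> 2" "ps \<noteq> []" "n > length ps"
    by linarith
  then show ?case
  proof cases
    case 1
    then show ?thesis by (subst (1 2) left_fold.simps) (auto simp: hd_append)
  next
    case 2
    define q where "q = (f (map fst (take n ps)) (butlast (map snd (take n ps))), snd (last (take n ps)))"
    have "left_fold f n (ps @ [(x, \<gamma>)]) = left_fold f n ((q # drop n ps) @ [(x, \<gamma>)])" for \<gamma>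
      using 2 by (subst left_fold.simps) (auto simp: q_def not_less)
    then show ?thesis using less[of "q # drop n ps"] 2 by simp
  next
    case 3
    then show ?thesis by (subst (1 2) left_fold.simps) (auto simp: butlast_append)
  qed
qed

section \<open>Words read off folded bracketings\<close>

text \<open>Every subword, including the last, carries a separator behind it, so that concatenation
  of lists becomes concatenation of words without a special case at the ends.\<close>

definition trailed_word :: "(('t, 'g) bracketing \<times> 'g) list \<Rightarrow> ('t + 'g) list" where
  "trailed_word ps = concat (map (\<lambda>(t, \<alpha>). bracketing_word t @ [Inr \<alpha>]) ps)"

lemma trailed_word_simps [simp]:
  "trailed_word [] = []"
  "trailed_word ((t, \<alpha>) # ps) = bracketing_word t @ Inr \<alpha> # trailed_word ps"
  "trailed_word (ps @ qs) = trailed_word ps @ trailed_word qs"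
  by (simp_all add: trailed_word_def)

text \<open>Links two conventions: \<open>bracketing_word\<close> puts each separator in front of
  the next subword, \<open>trailed_word\<close> puts it behind the previous one.\<close>

lemma interleave_trailing:
  assumes "qs = (t, \<alpha>) # ps"
  shows "bracketing_word t @ concat (map2 (\<lambda>\<alpha> v. Inr \<alpha> # v) (butlast (map snd qs)) (map (bracketing_word \<circ> fst) ps))
    @ [Inr (snd (last qs))] = trailed_word qs"
  using assms
proof (induction ps arbitrary: qs t \<alpha>)
  case Nil
  then show ?case by simp
next
  case (Cons p ps)
  obtain s \<beta> where p: "p = (s, \<beta>)" by force
  show ?case using Cons.IH[OF refl, of s \<beta>] Cons.prems p by simp
qed

lemma bracketing_word_Bracket:
  assumes "qs \<noteq> []"
  shows "bracketing_word (Bracket (map fst qs) (butlast (map snd qs))) @ [Inr (snd (last qs))] = trailed_word qs"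
proof -
  obtain t \<alpha> ps where qs: "qs = (t, \<alpha>) # ps" using assms by (cases qs) auto
  show ?thesis using interleave_trailing[OF qs] by (simp add: qs)
qed

text \<open>Each collapse replaces a block by a tree with the same word and keeps the block's last
  separator, so the trailed word is an invariant of the fold.\<close>

lemma bracketing_word_left_fold:
  assumes "ps \<noteq> []" "n \<ge> 2"
  shows "bracketing_word (left_fold Bracket n ps) @ [Inr (snd (last ps))] = trailed_word ps"
  using assms
proof (induction "length ps" arbitrary: ps rule: less_induct)
  case less
  show ?case
  proof (cases "length ps < 2")
    case True
    then obtain p where "ps = [p]" using less.prems by (cases ps) auto
    then show ?thesis by (cases p) simp
  next
    case False
    define b where "b = Bracket (map fst (take n ps)) (butlast (map snd (take n ps)))"
    define \<alpha> where "\<alpha> = snd (last (take n ps))"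
    have len: "length ((b, \<alpha>) # drop n ps) < length ps" using False less.prems by auto
    have "left_fold Bracket n ps = left_fold Bracket n ((b, \<alpha>) # drop n ps)"
      using False less.prems by (subst left_fold.simps) (simp add: b_def \<alpha>_def)
    moreover have "snd (last ps) = snd (last ((b, \<alpha>) # drop n ps))"
      using less.prems by (auto simp: \<alpha>_def last_drop)
    moreover have "trailed_word ((b, \<alpha>) # drop n ps) = trailed_word (take n ps) @ trailed_word (drop n ps)"
      using bracketing_word_Bracket[of "take n ps"] False less.prems
      by (simp add: b_def \<alpha>_def del: bracketing_word.simps flip: append_assoc)
    ultimately show ?thesis using less.hyps[OF len] less.prems
      by (simp del: trailed_word_simps(2) flip: trailed_word_simps(3))
  qed
qed

lemma trailed_word_map_concat:
  assumes "\<And>b. b \<in> set bs \<Longrightarrow> trailed_word [h b] = trailed_word (map k b)"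
  shows "trailed_word (map h bs) = trailed_word (map k (concat bs))"
  using assms
proof (induction bs)
  case (Cons b bs)
  have "trailed_word (map h (b # bs)) = trailed_word [h b] @ trailed_word (map h bs)"
    using trailed_word_simps(3)[of "[h b]" "map h bs"] by simp
  then show ?case using Cons by simp
qed simp

section \<open>Legal lengths and general associativity\<close>

locale nary_gamma_semiring_ge3 = nary_gamma_semiring +
  assumes n_ge_3: "n \<ge> 3"
begin

text \<open>One application of \<open>\<mu>\<close> lowers the number of \<open>T\<close>-letters by
  \<open>n - 1\<close>, so these are the lengths of words that can be reduced to a single
  letter.\<close>

definition legal_length :: "nat \<Rightarrow> bool" where
  "legal_length k \<longleftrightarrow> [k = 1] (mod (n - 1))"

text \<open>A pair list \<open>(x\<^sub>1, \<alpha>\<^sub>1), \<dots>, (x\<^sub>N, \<alpha>\<^sub>N)\<close> stands for the word \<open>x\<^sub>1 \<alpha>\<^sub>1 \<dots> \<alpha>\<^sub>N\<^sub>-\<^sub>1 x\<^sub>N\<close>: the last letter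
  \<open>\<alpha>\<^sub>N\<close> does not influence the value, but becomes the separator when words are concatenated.\<close>

abbreviation word_value :: "('a \<times> 'b) list \<Rightarrow> 'a" where
  "word_value \<equiv> left_fold \<mu> n"

lemma legal_length_nonempty: "legal_length (length ps) \<Longrightarrow> ps \<noteq> []"
  using n_ge_3 by (auto simp: legal_length_def cong_def)

lemma legal_length_1 [simp]: "legal_length (Suc 0)"
  by (simp add: legal_length_def)

lemma legal_length_n: "legal_length n"
  using n_ge_3 mod_add_self2[of 1 "n - 1"] by (simp add: legal_length_def cong_def)

lemma legal_length_cong: "[k = l] (mod (n - 1)) \<Longrightarrow> legal_length k \<longleftrightarrow> legal_length l"
  unfolding legal_length_def by (meson cong_sym cong_trans)

lemma legal_length_replace: "legal_length k \<Longrightarrow> legal_length (k + l) \<longleftrightarrow> legal_length (Suc l)"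
  using cong_add[of k 1 "n - 1" l l] by (intro legal_length_cong) (simp add: legal_length_def)

lemma legal_length_concat:
  assumes "\<forall>b\<in>set bs. legal_length (length b)"
  shows "legal_length (length (concat bs)) \<longleftrightarrow> legal_length (length bs)"
proof (rule legal_length_cong)
  show "[length (concat bs) = length bs] (mod (n - 1))"
    using assms
  proof (induction bs)
    case (Cons b bs)
    have "[length b + length (concat bs) = 1 + length bs] (mod (n - 1))"
      by (rule cong_add) (use Cons in \<open>auto simp: legal_length_def\<close>)
    then show ?case by simp
  qed simp
qed

text \<open>On a word of legal length the fold therefore never meets a block shorter than
  \<open>n\<close>, and the remaining word is again legal.\<close>

lemma legal_length_ge:
  assumes "legal_length k" "k \<ge> 2"
  shows "n \<le> k" "legal_length (Suc (k - n))"
proof -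
  have "(n - 1) dvd (k - 1)"
    using assms unfolding legal_length_def by (metis cong_to_1_nat One_nat_def)
  then have "n - 1 \<le> k - 1" using assms by (intro dvd_imp_le) auto
  then show "n \<le> k" using assms n_ge_3 by linarith
  then show "legal_length (Suc (k - n))"
    using assms(1) legal_length_replace[OF legal_length_n, of "k - n"] by simp
qed

lemma legal_bracketing_left_fold:
  assumes "legal_length (length ps)" "\<forall>p\<in>set ps. legal_bracketing n (fst p)"
  shows "legal_bracketing n (left_fold Bracket n ps)"
  using assms
proof (induction "length ps" arbitrary: ps rule: less_induct)
  case less
  show ?case
  proof (cases "length ps < 2")
    case True
    then obtain p where "ps = [p]"
      using legal_length_nonempty[OF less.prems(1)] by (cases ps) auto
    then show ?thesis using less.prems by simp
  next
    case False
    define q where "q = (Bracket (map fst (take n ps)) (butlast (map snd (take n ps))), snd (last (take n ps)))"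
    have ge: "n \<le> length ps" using False less.prems by (intro legal_length_ge) auto
    have "left_fold Bracket n ps = left_fold Bracket n (q # drop n ps)"
      using False n_ge_3 by (subst left_fold.simps) (simp add: q_def)
    moreover have "legal_bracketing n (left_fold Bracket n (q # drop n ps))"
    proof (rule less.hyps)
      show "length (q # drop n ps) < length ps" using ge n_ge_3 by simp
      show "legal_length (length (q # drop n ps))" using False less.prems legal_length_ge by simp
      show "\<forall>p\<in>set (q # drop n ps). legal_bracketing n (fst p)"
        using less.prems(2) ge
        by (auto simp: q_def nary_args_def dest: in_set_takeD in_set_dropD)
    qed
    ultimately show ?thesis by simp
  qed
qed

text \<open>Folding the whole word, and folding the blocks first, are two legal bracketings of the
  same word, so \<open>associative\<close> equates their values. Every later regrouping of a word
  rests on this.\<close>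

lemma word_value_concat:
  assumes "\<forall>b\<in>set bs. legal_length (length b)" "legal_length (length bs)"
  shows "word_value (concat bs) = word_value (map (\<lambda>b. (word_value b, snd (last b))) bs)"
proof -
  define leaves :: "('a \<times> 'b) list \<Rightarrow> (('a, 'b) bracketing \<times> 'b) list"
    where "leaves = map (map_prod Letter id)"
  define tree where "tree b = left_fold Bracket n (leaves b)" for b
  define S where "S = map (\<lambda>b. (tree b, snd (last b))) bs"
  have fold_value: "bracketing_value \<mu> (left_fold Bracket n ps)
      = word_value (map (map_prod (bracketing_value \<mu>) id) ps)" if "ps \<noteq> []" for ps
    using that by (intro left_fold_hom) simp_all
  have value_tree: "bracketing_value \<mu> (tree b) = word_value b" if "b \<noteq> []" for b
    using that by (simp add: tree_def fold_value leaves_def comp_def map_prod_def case_prod_beta)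
  have legal_tree: "legal_bracketing n (tree b)" if "legal_length (length b)" for b
    using that by (auto simp: tree_def leaves_def intro!: legal_bracketing_left_fold)
  have ne: "b \<noteq> []" if "b \<in> set bs" for b using that assms(1) legal_length_nonempty by blast
  have bs: "bs \<noteq> []" using assms(2) legal_length_nonempty by blast
  have lc: "legal_length (length (concat bs))" using assms legal_length_concat by blast
  have "trailed_word [(tree b, snd (last b))] = trailed_word (leaves b)" if "b \<in> set bs" for b
    using bracketing_word_left_fold[of "leaves b" n] ne[OF that] n_ge_3
    by (simp add: tree_def leaves_def last_map)
  then have "trailed_word S = trailed_word (leaves (concat bs))"
    unfolding S_def leaves_def by (intro trailed_word_map_concat) simp
  moreover have "bracketing_word (left_fold Bracket n S) @ [Inr (snd (last S))] = trailed_word S"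
    using bs n_ge_3 by (intro bracketing_word_left_fold) (auto simp: S_def)
  moreover have "bracketing_word (tree (concat bs)) @ [Inr (snd (last (leaves (concat bs))))]
      = trailed_word (leaves (concat bs))"
    unfolding tree_def
    using legal_length_nonempty[OF lc] n_ge_3
    by (intro bracketing_word_left_fold) (simp_all add: leaves_def)
  \<comment> \<open>Both trailed words coincide; cancelling their final separators leaves the words
    themselves.\<close>
  ultimately have "bracketing_word (tree (concat bs)) = bracketing_word (left_fold Bracket n S)"
    by (metis append1_eq_conv)
  moreover have "legal_bracketing n (left_fold Bracket n S)"
    using assms legal_tree by (intro legal_bracketing_left_fold) (auto simp: S_def)
  ultimately have "bracketing_value \<mu> (tree (concat bs)) = bracketing_value \<mu> (left_fold Bracket n S)"
    using legal_tree lc by (intro associative)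
  also have "\<dots> = word_value (map (\<lambda>b. (word_value b, snd (last b))) bs)"
    using bs ne by (subst fold_value) (auto simp: S_def value_tree intro!: arg_cong[of _ _ word_value])
  finally show ?thesis using value_tree lc legal_length_nonempty by metis
qed

lemma legal_length_concat_replicate:
  "legal_length (length w) \<Longrightarrow> legal_length k \<Longrightarrow> legal_length (length (concat (replicate k w)))"
  by (subst legal_length_concat) simp_all

lemma word_value_block:
  assumes "legal_length (length b)" "legal_length (length (u @ b @ v))"
  shows "word_value (u @ b @ v) = word_value (u @ (word_value b, snd (last b)) # v)"
proof -
  \<comment> \<open>All entries outside \<open>b\<close> become blocks of length one, whose collapse
    changes nothing.\<close>
  define bs where "bs = map (\<lambda>x. [x]) u @ b # map (\<lambda>x. [x]) v"
  have c: "concat bs = u @ b @ v" by (simp add: bs_def concat_map_singleton[of "\<lambda>x. x", simplified])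
  have a: "\<forall>b\<in>set bs. legal_length (length b)" using assms by (auto simp: bs_def)
  have "legal_length (length bs)" using legal_length_concat[OF a] c assms by simp
  from word_value_concat[OF a this] show ?thesis unfolding c by (simp add: bs_def comp_def)
qed

lemma word_value_n:
  assumes "length ps = n"
  shows "word_value ps = \<mu> (map fst ps) (butlast (map snd ps))"
  using assms n_ge_3 by (intro left_fold_exact) auto

lemma word_value_zip:
  assumes "length xs = n" "length as = n - 1"
  shows "word_value (zip xs (as @ [\<alpha>])) = \<mu> xs as"
  using assms n_ge_3 by (subst word_value_n) auto

text \<open>The first collapse either absorbs a letter of \<open>I\<close> and gives a value in
  \<open>I\<close>, or leaves such a letter to its right.\<close>

lemma word_value_in_ideal:
  assumes "nary_ideal n \<mu> I" "legal_length (length ps)" "\<exists>p\<in>set ps. fst p \<in> I"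
  shows "word_value ps \<in> I"
  using assms(2,3)
proof (induction "length ps" arbitrary: ps rule: less_induct)
  case less
  show ?case
  proof (cases "length ps < 2")
    case True
    then obtain p where "ps = [p]"
      using legal_length_nonempty[OF less.prems(1)] by (cases ps) auto
    then show ?thesis using less.prems by simp
  next
    case False
    define x where "x = \<mu> (map fst (take n ps)) (butlast (map snd (take n ps)))"
    have ge: "n \<le> length ps" using False less.prems by (intro legal_length_ge) auto
    have "word_value ps = word_value ((x, snd (last (take n ps))) # drop n ps)"
      using False n_ge_3 by (subst left_fold.simps) (simp add: x_def)
    moreover have "word_value ((x, snd (last (take n ps))) # drop n ps) \<in> I"
    proof (rule less.hyps)
      show "length ((x, snd (last (take n ps))) # drop n ps) < length ps" using ge n_ge_3 by simp
      show "legal_length (length ((x, snd (last (take n ps))) # drop n ps))"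
        using False less.prems legal_length_ge by simp
      have "x \<in> I" if "\<exists>p\<in>set (take n ps). fst p \<in> I"
        using assms(1) that ge unfolding nary_ideal_def x_def
        by (auto simp: nary_args_def)
      moreover have "(\<exists>p\<in>set (take n ps). fst p \<in> I) \<or> (\<exists>p\<in>set (drop n ps). fst p \<in> I)"
        using less.prems(2) by (metis Un_iff append_take_drop_id set_append)
      ultimately show "\<exists>p\<in>set ((x, snd (last (take n ps))) # drop n ps). fst p \<in> I"
        by auto
    qed
    ultimately show ?thesis by simp
  qed
qed

lemma word_value_block_in_ideal:
  assumes "nary_ideal n \<mu> I" "legal_length (length b)" "word_value b \<in> I"
    "legal_length (length (u @ b @ v))"
  shows "word_value (u @ b @ v) \<in> I"
  unfolding word_value_block[OF assms(2,4)]
  using assms legal_length_replace[OF assms(2), of "length u + length v"]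
  by (intro word_value_in_ideal) (auto simp: algebra_simps)

lemma legal_length_mult: "legal_length k \<Longrightarrow> legal_length l \<Longrightarrow> legal_length (k * l)"
  using cong_mult[of k 1 "n - 1" l 1] by (simp add: legal_length_def)

lemma legal_length_power: "legal_length (n ^ k)"
  by (induction k) (auto intro: legal_length_mult legal_length_n)

lemma legal_length_add: "legal_length (Suc k) \<Longrightarrow> legal_length (k + l) \<longleftrightarrow> legal_length l"
proof (rule legal_length_cong)
  assume "legal_length (Suc k)"
  then have "[1 + k = 1 + 0] (mod (n - 1))" by (simp add: legal_length_def)
  then have "[k = 0] (mod (n - 1))" by (simp only: cong_add_lcancel_nat)
  then show "[k + l = l] (mod (n - 1))"
    using cong_add[of k 0 "n - 1" l l] by simp
qed

text \<open>Since \<open>l\<close> is 1 modulo \<open>n - 1\<close>, the choice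
  \<open>i = (n - 2) * m\<close>, which is \<open>-m\<close> modulo \<open>n - 1\<close>, cancels
  \<open>m\<close>.\<close>

lemma ex_legal_padding:
  assumes "legal_length l"
  shows "\<exists>i. legal_length (Suc (i * l + m))"
proof
  have "[(n - 2) * m * l + m = (n - 2) * m * 1 + m] (mod (n - 1))"
    using assms unfolding legal_length_def by (intro cong_add cong_mult cong_refl)
  moreover have "(n - 2) * m * 1 + m = (n - 1) * m"
  proof -
    have "n - 1 = Suc (n - 2)" using n_ge_3 by simp
    then show ?thesis by simp
  qed
  ultimately have "[(n - 2) * m * l + m = 0] (mod (n - 1))"
    by (simp add: cong_def)
  from cong_add[OF cong_refl this, of 1]
  show "legal_length (Suc ((n - 2) * m * l + m))"
    by (simp add: legal_length_def)
qed

end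

section \<open>Powers of words and semiprime ideals\<close>

lemma concat_replicate_add:
  "concat (replicate (k + l) w) = concat (replicate k w) @ concat (replicate l w)"
  by (simp add: replicate_add)

lemma concat_replicate_mult:
  "concat (replicate (k * l) w) = concat (replicate k (concat (replicate l w)))"
  by (induction k) (simp_all add: concat_replicate_add)

locale nary_semiprime_ideal = nary_gamma_semiring_ge3 +
  fixes P
  assumes semiprime: "nary_semiprime n \<mu> P"
begin

lemma ideal: "nary_ideal n \<mu> P"
  using semiprime by (simp add: nary_semiprime_def)

text \<open>By associativity the value of the power is \<open>\<mu>\<close> applied to
  \<open>n\<close> copies of the value of \<open>w\<close>, all separated by the last separator of
  \<open>w\<close>.\<close>

lemma word_value_root:
  assumes "legal_length (length w)" "word_value (concat (replicate n w)) \<in> P"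
  shows "word_value w \<in> P"
proof -
  have "word_value (concat (replicate n w)) = word_value (replicate n (word_value w, snd (last w)))"
    using assms legal_length_n by (subst word_value_concat) auto
  also have "\<dots> = \<mu> (replicate n (word_value w)) (butlast (replicate n (snd (last w))))"
    by (subst word_value_n) auto
  finally have "\<mu> (replicate n (word_value w)) (butlast (replicate n (snd (last w)))) \<in> P"
    using assms(2) by simp
  moreover have "length (butlast (replicate n (snd (last w)))) = n - 1" by simp
  ultimately show ?thesis using semiprime unfolding nary_semiprime_def by blast
qed

lemma word_value_power_root:
  assumes "legal_length (length w)" "word_value (concat (replicate (n ^ k) w)) \<in> P"
  shows "word_value w \<in> P"
  using assms(2)
proof (induction k)
  case (Suc k)
  have "word_value (concat (replicate n (concat (replicate (n ^ k) w)))) \<in> P"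
    using Suc.prems by (simp only: power_Suc concat_replicate_mult)
  moreover have "legal_length (length (concat (replicate (n ^ k) w)))"
    by (intro legal_length_concat_replicate assms legal_length_power)
  ultimately have "word_value (concat (replicate (n ^ k) w)) \<in> P"
    using word_value_root by blast
  then show ?case by (rule Suc.IH)
qed simp

text \<open>The square of \<open>x s y\<close> contains \<open>y x\<close> as a factor.\<close>

lemma square_factor:
  assumes "legal_length (length (x @ s @ y))" "legal_length (length (y @ x))" "word_value (y @ x) \<in> P"
  shows "word_value (x @ s @ y) \<in> P"
proof (rule word_value_root[OF assms(1)])
  let ?u = "x @ s @ y"
  \<comment> \<open>Two copies of the word provide the factor \<open>y @ x\<close>; the other
    \<open>n - 2\<close> make the power legal.\<close>
  have "n = 2 + (n - 2)" using n_ge_3 by simp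
  then have "concat (replicate n ?u) = concat (replicate (2 + (n - 2)) ?u)" by (rule arg_cong)
  also have "\<dots> = (x @ s) @ (y @ x) @ (s @ y @ concat (replicate (n - 2) ?u))"
    unfolding concat_replicate_add by (simp add: numeral_2_eq_2)
  finally have eq: "concat (replicate n ?u) = (x @ s) @ (y @ x) @ (s @ y @ concat (replicate (n - 2) ?u))" .
  have "legal_length (length (concat (replicate n ?u)))"
    by (intro legal_length_concat_replicate assms legal_length_n)
  then show "word_value (concat (replicate n ?u)) \<in> P"
    unfolding eq by (intro word_value_block_in_ideal ideal assms)
qed

lemma word_value_rotate:
  assumes "legal_length (length (p @ q))" "word_value (p @ q) \<in> P"
  shows "word_value (q @ p) \<in> P"
  using square_factor[of q "[]" p] assms by (simp add: add.commute)

text \<open>A gap of length 0 modulo \<open>n - 1\<close> keeps the word legal, and after rotation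
  to \<open>y @ x\<close> the squaring argument applies.\<close>

lemma word_value_insert:
  assumes "legal_length (length (x @ y))" "word_value (x @ y) \<in> P" "legal_length (Suc (length s))"
  shows "word_value (x @ s @ y) \<in> P"
proof (rule square_factor)
  show "legal_length (length (x @ s @ y))"
    using assms(1) legal_length_add[OF assms(3), of "length (x @ y)"] by (simp add: algebra_simps)
  show "legal_length (length (y @ x))" using assms(1) by (simp add: add.commute)
  show "word_value (y @ x) \<in> P" by (rule word_value_rotate) (use assms in auto)
qed

text \<open>Rotation brings each separator in turn to the last position, where it may be changed
  freely.\<close>

lemma word_value_change_separators:
  assumes "legal_length (length (ps @ r))" "word_value (ps @ r) \<in> P" "map fst ps = map fst qs"
  shows "word_value (r @ qs) \<in> P"
  using assms
proof (induction ps arbitrary: qs r)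
  case (Cons p ps)
  obtain x \<alpha> where p: "p = (x, \<alpha>)" by force
  then obtain \<beta> qs' where qs: "qs = (x, \<beta>) # qs'" using Cons.prems(3) by (cases qs) auto
  have "word_value ((ps @ r) @ [p]) \<in> P"
    by (rule word_value_rotate) (use Cons.prems in auto)
  then have "word_value (ps @ (r @ [(x, \<beta>)])) \<in> P"
    using left_fold_last_letter[of \<mu> n "ps @ r" x \<alpha> \<beta>] by (simp add: p)
  then have "word_value ((r @ [(x, \<beta>)]) @ qs') \<in> P"
    by (rule Cons.IH[rotated]) (use Cons.prems qs in auto)
  then show ?case by (simp add: qs)
qed simp

text \<open>The letters of \<open>v\<close> are traded one by one for whole copies of \<open>w\<close>: padding by further copies
  of \<open>w\<close>, which have length 1 modulo \<open>n - 1\<close>, makes the inserted gaps have length 0 modulo \<open>n - 1\<close>.\<close>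

lemma word_value_absorb_into_power:
  assumes "legal_length (length w)"
    and "legal_length (length (v @ r))" "word_value (v @ r) \<in> P" "fst ` set v \<subseteq> fst ` set w"
  shows "\<exists>k. legal_length (length (r @ concat (replicate k w))) \<and> word_value (r @ concat (replicate k w)) \<in> P"
  using assms(2-)
proof (induction v arbitrary: r)
  case Nil
  then show ?case by (intro exI[of _ 0]) simp
next
  case (Cons p v)
  obtain \<beta> where "(fst p, \<beta>) \<in> set w" using Cons.prems(3) by auto
  then obtain w1 w2 where w: "w = w1 @ (fst p, \<beta>) # w2" by (meson split_list)
  let ?q = "(fst p, \<beta>)"
  obtain i where i: "legal_length (Suc (i * length w + length w1))"
    using ex_legal_padding[OF assms(1)] by blast
  obtain j where j: "legal_length (Suc (j * length w + length w2))"
    using ex_legal_padding[OF assms(1)] by blast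
  \<comment> \<open>Around the letter \<open>?q\<close> these complete a power:
    \<open>?s @ [?q] @ ?t\<close> consists of \<open>i + 1 + j\<close> copies of
    \<open>w\<close>.\<close>
  let ?s = "concat (replicate i w) @ w1" and ?t = "w2 @ concat (replicate j w)"
  have pow: "length (concat (replicate k w)) = k * length w" for k
    by (induction k) auto
  have ls: "legal_length (Suc (length ?s))" and lt: "legal_length (Suc (length ?t))"
    using i j by (simp_all add: pow add.commute)
  have l0: "legal_length (length ((v @ r) @ [?q]))" using Cons.prems(1) by simp
  have "word_value ((v @ r) @ [p]) \<in> P"
    by (rule word_value_rotate) (use Cons.prems in auto)
  then have "word_value ((v @ r) @ [?q]) \<in> P"
    using left_fold_last_letter[of \<mu> n "v @ r" "fst p" "snd p" \<beta>] by simp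
  then have "word_value ((v @ r) @ ?s @ [?q]) \<in> P"
    by (rule word_value_insert[OF l0 _ ls])
  moreover have l1: "legal_length (length ((v @ r) @ ?s @ [?q]))"
    using legal_length_add[OF ls, of "length ((v @ r) @ [?q])"] l0 by (simp add: algebra_simps)
  ultimately have "word_value (((v @ r) @ ?s @ [?q]) @ ?t @ []) \<in> P"
    by (intro word_value_insert[OF _ _ lt]) simp_all
  moreover have "((v @ r) @ ?s @ [?q]) @ ?t @ [] = v @ (r @ concat (replicate (i + 1 + j) w))"
    unfolding concat_replicate_add by (simp add: w)
  moreover have "legal_length (length (((v @ r) @ ?s @ [?q]) @ ?t @ []))"
    using legal_length_add[OF lt, of "length ((v @ r) @ ?s @ [?q])"] l1 by (simp add: algebra_simps)
  ultimately have "\<exists>k. legal_length (length ((r @ concat (replicate (i + 1 + j) w)) @ concat (replicate k w))) \<and>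
      word_value ((r @ concat (replicate (i + 1 + j) w)) @ concat (replicate k w)) \<in> P"
    using Cons.prems(3) by (intro Cons.IH) (metis, metis, auto)
  then show ?case
    by (metis append.assoc concat_replicate_add)
qed

text \<open>The letters of \<open>v\<close> are absorbed into some power of \<open>w\<close>. That
  power is a factor of the \<open>n ^ k\<close>-th power, from which \<open>k\<close> successive
  \<open>n\<close>-th roots lead back to \<open>w\<close>.\<close>

theorem word_value_mono_letters:
  assumes "legal_length (length v)" "word_value v \<in> P"
    and "legal_length (length w)" "fst ` set v \<subseteq> fst ` set w"
  shows "word_value w \<in> P"
proof -
  obtain k where k: "legal_length (length (concat (replicate k w)))" "word_value (concat (replicate k w)) \<in> P"
    using word_value_absorb_into_power[of w v "[]"] assms by auto
  have "k \<le> 2 ^ k" by (rule less_imp_le) simp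
  also have "\<dots> \<le> n ^ k" using n_ge_3 by (intro power_mono) auto
  finally have "k \<le> n ^ k" .
  then have "concat (replicate (n ^ k) w) = [] @ concat (replicate k w) @ concat (replicate (n ^ k - k) w)"
    by (simp flip: concat_replicate_add)
  moreover have "legal_length (length (concat (replicate (n ^ k) w)))"
    by (intro legal_length_concat_replicate assms legal_length_power)
  ultimately have "word_value (concat (replicate (n ^ k) w)) \<in> P"
    using k word_value_block_in_ideal[OF ideal k, of "[]"] by metis
  then show ?thesis by (rule word_value_power_root[OF assms(3)])
qed

section \<open>Colon ideals of a semiprime ideal\<close>

text \<open>Quantifying over \<open>\<alpha>\<close> avoids a choice of separator; for
  \<open>u\<close> of length \<open>n - 1\<close> any single one gives the same set.\<close>

definition colon :: "('a \<times> 'b) list \<Rightarrow> 'a set" where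
  "colon u = {y. \<forall>\<alpha>. word_value ((y, \<alpha>) # u) \<in> P}"

lemma colon_iff:
  assumes "length u = n - 1"
  shows "y \<in> colon u \<longleftrightarrow> word_value ((y, \<alpha>) # u) \<in> P"
proof -
  have "word_value ((y, \<beta>) # u) \<in> P" if "word_value ((y, \<alpha>) # u) \<in> P" for \<beta>
    by (rule word_value_mono_letters[OF _ that]) (use assms n_ge_3 legal_length_n in auto)
  then show ?thesis by (auto simp: colon_def)
qed

lemma colon_superset:
  assumes "length u = n - 1"
  shows "P \<subseteq> colon u"
proof
  fix y assume "y \<in> P"
  then show "y \<in> colon u" unfolding colon_def
    using assms n_ge_3 legal_length_n by (auto intro!: word_value_in_ideal ideal)
qed

text \<open>Unfolds membership of a product into a word of length \<open>2 * n - 1\<close>, in a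
  form to which monotonicity in the letter set applies.\<close>

lemma colon_value_iff:
  assumes "length u = n - 1" "nary_args n xs as"
  shows "\<mu> xs as \<in> colon u \<longleftrightarrow> word_value (zip xs (as @ [\<alpha>]) @ u) \<in> P"
    and "legal_length (length (zip xs (as @ [\<alpha>]) @ u))"
    and "fst ` set (zip xs (as @ [\<alpha>]) @ u) = set xs \<union> fst ` set u"
proof -
  let ?z = "zip xs (as @ [\<alpha>])"
  have len_xs: "length xs = length (as @ [\<alpha>])" "xs \<noteq> []"
    using assms n_ge_3 by (auto simp: nary_args_def)
  have z: "length ?z = n" "last ?z = (last xs, \<alpha>)"
    using assms len_xs by (simp_all add: nary_args_def last_zip)
  have "length ((\<mu> xs as, \<alpha>) # u) = n" using assms n_ge_3 by simp
  then show l: "legal_length (length (?z @ u))"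
    using legal_length_replace[OF legal_length_n, of "length u"] legal_length_n z by simp
  have "word_value ([] @ ?z @ u) = word_value ([] @ (word_value ?z, snd (last ?z)) # u)"
    using l z legal_length_n by (intro word_value_block) auto
  also have "\<dots> = word_value ((\<mu> xs as, \<alpha>) # u)"
    using assms z by (simp add: word_value_zip nary_args_def)
  finally show "\<mu> xs as \<in> colon u \<longleftrightarrow> word_value (?z @ u) \<in> P"
    using colon_iff[OF assms(1)] by simp
  have "map fst ?z = xs" using assms n_ge_3 by (auto simp: nary_args_def)
  then have "fst ` set ?z = set xs" by (metis set_map)
  then show "fst ` set (?z @ u) = set xs \<union> fst ` set u" by (simp add: image_Un)
qed

text \<open>Sums are handled by additivity in the first position. Absorption and roots reduce to
  inclusions between letter sets; for roots the two sets are equal.\<close>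

lemma colon_semiprime:
  assumes u: "length u = n - 1"
  shows "nary_semiprime n \<mu> (colon u)"
proof -
  fix \<gamma> :: 'b
  have len: "legal_length (length ((y, \<gamma>) # u))" for y using u n_ge_3 legal_length_n by simp
  have add: "x + y \<in> colon u" if "x \<in> colon u" "y \<in> colon u" for x y
  proof -
    \<comment> \<open>The leading \<open>0\<close> is a placeholder, overwritten at once, that
      brings the value into the shape of \<open>additive\<close>.\<close>
    have v: "word_value ((z, \<gamma>) # u) = \<mu> ((0 # map fst u)[0 := z]) (butlast (\<gamma> # map snd u))" for z
      using u n_ge_3 by (subst word_value_n) auto
    have "word_value ((x + y, \<gamma>) # u) = word_value ((x, \<gamma>) # u) + word_value ((y, \<gamma>) # u)"
      unfolding v using u n_ge_3 by (intro additive) (auto simp: nary_args_def)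
    then show ?thesis
      using that ideal colon_iff[OF u, of _ \<gamma>] by (auto simp: nary_ideal_def)
  qed
  have absorb: "\<mu> xs as \<in> colon u" if a: "nary_args n xs as" and x: "x \<in> set xs" "x \<in> colon u" for xs as x
    unfolding colon_value_iff(1)[OF u a, of \<gamma>]
  proof (rule word_value_mono_letters)
    show "word_value ((x, \<gamma>) # u) \<in> P" using x colon_iff[OF u] by blast
    show "fst ` set ((x, \<gamma>) # u) \<subseteq> fst ` set (zip xs (as @ [\<gamma>]) @ u)"
      unfolding colon_value_iff(3)[OF u a, of \<gamma>] using x by auto
  qed (use len colon_value_iff(2)[OF u a, of \<gamma>] in blast)+
  have root: "x \<in> colon u" if as: "length as = n - 1" and x: "\<mu> (replicate n x) as \<in> colon u" for x as
    unfolding colon_iff[OF u, of _ \<gamma>]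
  proof (rule word_value_mono_letters)
    have a: "nary_args n (replicate n x) as" using as by (simp add: nary_args_def)
    show "word_value (zip (replicate n x) (as @ [\<gamma>]) @ u) \<in> P"
      using x colon_value_iff(1)[OF u a] by blast
    show "fst ` set (zip (replicate n x) (as @ [\<gamma>]) @ u) \<subseteq> fst ` set ((x, \<gamma>) # u)"
      unfolding colon_value_iff(3)[OF u a, of \<gamma>] by auto
    show "legal_length (length (zip (replicate n x) (as @ [\<gamma>]) @ u))"
      by (rule colon_value_iff(2)[OF u a])
  qed (rule len)
  have "colon u \<noteq> {}" using colon_superset[OF u] ideal by (auto simp: nary_ideal_def)
  then show ?thesis
    using add absorb root unfolding nary_semiprime_def nary_ideal_def by blast
qed

section \<open>Primeness of maximal semiprime ideals avoiding an element\<close>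

theorem prime_if_maximal_avoiding:
  assumes a: "a \<notin> P"
    and maximal: "\<And>R. nary_semiprime n \<mu> R \<Longrightarrow> P \<subseteq> R \<Longrightarrow> a \<notin> R \<Longrightarrow> R = P"
  shows "nary_prime n \<mu> P"
proof -
  fix \<gamma> :: 'b
  \<comment> \<open>Here \<open>xs\<close> holds the letters still to be treated, and
    \<open>k\<close> counts those already replaced by \<open>a\<close>.\<close>
  have replace: "\<exists>x\<in>set xs. x \<in> P"
    if "length xs + k = n" "word_value (map (\<lambda>x. (x, \<gamma>)) (xs @ replicate k a)) \<in> P" for xs k
    using that
  proof (induction xs arbitrary: k)
    case Nil
    have "word_value [(a, \<gamma>)] \<in> P"
      by (rule word_value_mono_letters[OF _ Nil(2)]) (use Nil legal_length_n in auto)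
    then show ?case using a by simp
  next
    case (Cons x xs)
    show ?case
    proof (cases "x \<in> P")
      case False
      let ?u = "map (\<lambda>x. (x, \<gamma>)) (xs @ replicate k a)"
      have u: "length ?u = n - 1" using Cons.prems by auto
      have "x \<in> colon ?u" using Cons.prems colon_iff[OF u, of x \<gamma>] by simp
      then have "colon ?u \<noteq> P" using False by blast
      then have "a \<in> colon ?u"
        using maximal[OF colon_semiprime[OF u] colon_superset[OF u]] by blast
      then have a_u: "word_value ((a, \<gamma>) # ?u) \<in> P" using colon_iff[OF u] by blast
      \<comment> \<open>Moving the new \<open>a\<close> from the front to the back leaves the letter
        set unchanged.\<close>
      have "word_value (map (\<lambda>x. (x, \<gamma>)) (xs @ replicate (Suc k) a)) \<in> P"
        by (rule word_value_mono_letters[OF _ a_u]) (use Cons.prems legal_length_n in auto)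
      then show ?thesis using Cons.IH[of "Suc k"] Cons.prems(1) by simp
    qed simp
  qed
  have "\<exists>x\<in>set xs. x \<in> P" if "nary_args n xs as" "\<mu> xs as \<in> P" for xs as
  proof (rule replace[of xs 0])
    let ?z = "zip xs (as @ [\<gamma>])"
    have z: "word_value ?z \<in> P" "length ?z = n" "map fst ?z = xs"
      using that n_ge_3 by (auto simp: nary_args_def word_value_zip)
    show "word_value (map (\<lambda>x. (x, \<gamma>)) (xs @ replicate 0 a)) \<in> P"
      using word_value_change_separators[of ?z "[]" "map (\<lambda>x. (x, \<gamma>)) xs"] z legal_length_n
      by (simp add: comp_def)
    show "length xs + 0 = n" using that by (simp add: nary_args_def)
  qed
  then show ?thesis using a ideal unfolding nary_prime_def by blast
qed

end

section \<open>The prime radical and the lattice of ideals\<close>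

context nary_gamma_semiring_ge3
begin

text \<open>Only closure under sums involves two members of the chain, and there comparability
  provides a common one.\<close>

lemma semiprime_Union_chain:
  assumes "C \<noteq> {}" "\<And>P. P \<in> C \<Longrightarrow> nary_semiprime n \<mu> P" "subset.chain UNIV C"
  shows "nary_semiprime n \<mu> (\<Union>C)"
  unfolding nary_semiprime_def nary_ideal_def
proof (intro conjI ballI allI impI)
  have ideal: "nary_ideal n \<mu> I" if "I \<in> C" for I
    using assms(2)[OF that] by (simp add: nary_semiprime_def)
  obtain I where "I \<in> C" using assms(1) by blast
  then show "\<Union>C \<noteq> {}" using ideal[of I] unfolding nary_ideal_def by blast
  show "x + y \<in> \<Union>C" if xy: "x \<in> \<Union>C" "y \<in> \<Union>C" for x y
  proof -
    obtain I J where IJ: "x \<in> I" "I \<in> C" "y \<in> J" "J \<in> C" using xy by blast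
    then have "I \<subseteq> J \<or> J \<subseteq> I" using assms(3) by (auto simp: subset_chain_def)
    then obtain K where "K \<in> C" "x \<in> K" "y \<in> K" using IJ by blast
    then show ?thesis using ideal[of K] unfolding nary_ideal_def by blast
  qed
  show "\<mu> xs as \<in> \<Union>C" if a: "nary_args n xs as" and x: "\<exists>x\<in>set xs. x \<in> \<Union>C" for xs as
  proof -
    obtain I where "I \<in> C" "\<exists>x\<in>set xs. x \<in> I" using x by blast
    then show ?thesis using ideal[of I] a unfolding nary_ideal_def by blast
  qed
  show "a \<in> \<Union>C" if as: "length as = n - 1" and a: "\<mu> (replicate n a) as \<in> \<Union>C" for a as
  proof -
    obtain I where "I \<in> C" "\<mu> (replicate n a) as \<in> I" using a by blast
    then show ?thesis using assms(2)[of I] as unfolding nary_semiprime_def by blast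
  qed
qed

lemma ex_prime_avoiding:
  assumes "nary_semiprime n \<mu> Q" "a \<notin> Q"
  shows "\<exists>P. nary_prime n \<mu> P \<and> Q \<subseteq> P \<and> a \<notin> P"
proof -
  let ?A = "{P. nary_semiprime n \<mu> P \<and> Q \<subseteq> P \<and> a \<notin> P}"
  have "\<exists>M\<in>?A. \<forall>X\<in>?A. M \<subseteq> X \<longrightarrow> X = M"
  proof (rule subset_Zorn_nonempty)
    show "?A \<noteq> {}" using assms by blast
    fix C assume C: "C \<noteq> {}" "subset.chain ?A C"
    then have "nary_semiprime n \<mu> (\<Union>C)"
      by (intro semiprime_Union_chain) (auto simp: subset_chain_def)
    then show "\<Union>C \<in> ?A" using C by (auto simp: subset_chain_def)
  qed
  then obtain M where M: "M \<in> ?A" "\<forall>X\<in>?A. M \<subseteq> X \<longrightarrow> X = M" by blast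
  interpret nary_semiprime_ideal n \<mu> M by unfold_locales (use M in auto)
  have "nary_prime n \<mu> M" using M by (intro prime_if_maximal_avoiding[of a]) auto
  then show ?thesis using M by blast
qed

lemma radical_of_semiprime: "nary_semiprime n \<mu> Q \<Longrightarrow> nary_radical n \<mu> Q = Q"
  using ex_prime_avoiding unfolding nary_radical_def by blast

lemma prime_imp_semiprime: "nary_prime n \<mu> P \<Longrightarrow> nary_semiprime n \<mu> P"
  unfolding nary_prime_def nary_semiprime_def
  by (metis in_set_replicate length_replicate nary_args_def)

text \<open>A product of an element of \<open>I\<close> with zeros lies in \<open>I\<close> and
  equals \<open>0\<close>. This keeps intersections of ideals nonempty.\<close>

lemma zero_in_ideal:
  assumes "nary_ideal n \<mu> I"
  shows "0 \<in> I"
proof -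
  fix \<gamma> :: 'b
  obtain x where x: "x \<in> I" using assms by (auto simp: nary_ideal_def)
  let ?xs = "x # replicate (n - 1) 0" and ?as = "replicate (n - 1) \<gamma>"
  have args: "nary_args n ?xs ?as" using n_ge_3 by (simp add: nary_args_def)
  then have "\<mu> ?xs ?as \<in> I" using assms x unfolding nary_ideal_def by auto
  moreover have "\<mu> ?xs ?as = 0" using args n_ge_3 by (intro absorbing) auto
  ultimately show ?thesis by simp
qed

lemma ideal_Inter:
  assumes "\<And>I. I \<in> C \<Longrightarrow> nary_ideal n \<mu> I"
  shows "nary_ideal n \<mu> (\<Inter>C)"
proof -
  have "0 \<in> \<Inter>C" using assms zero_in_ideal by blast
  then have "\<Inter>C \<noteq> {}" by blast
  then show ?thesis using assms unfolding nary_ideal_def by blast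
qed

lemma radical_ideal: "nary_ideal n \<mu> (nary_radical n \<mu> I)"
  unfolding nary_radical_def by (rule ideal_Inter) (auto simp: nary_prime_def)

lemma radical_semiprime: "nary_semiprime n \<mu> (nary_radical n \<mu> I)"
  using radical_ideal prime_imp_semiprime unfolding nary_semiprime_def nary_radical_def by blast

text \<open>Meets are intersections and the greatest ideal is all of \<open>T\<close>; joins then
  exist by the standard criterion.\<close>

lemma ideal_complete_lattice: "complete_lattice (ideal_lattice n \<mu>)"
proof -
  interpret partial_order "ideal_lattice n \<mu>"
    by unfold_locales (auto simp: ideal_lattice_def)
  have UNIV_ideal: "nary_ideal n \<mu> UNIV" by (simp add: nary_ideal_def)
  show ?thesis
  proof (rule complete_lattice_criterion1)
    show "\<exists>g. greatest (ideal_lattice n \<mu>) g (carrier (ideal_lattice n \<mu>))"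
      using UNIV_ideal by (intro exI[of _ UNIV]) (auto simp: greatest_def ideal_lattice_def)
    fix A assume A: "A \<subseteq> carrier (ideal_lattice n \<mu>)"
    then have "nary_ideal n \<mu> (\<Inter>A)"
      by (intro ideal_Inter) (auto simp: ideal_lattice_def)
    then show "\<exists>i. greatest (ideal_lattice n \<mu>) i (Lower (ideal_lattice n \<mu>) A)"
      using A by (intro exI[of _ "\<Inter>A"]) (auto simp: greatest_def Lower_def ideal_lattice_def)
  qed
qed

text \<open>Extensivity and isotonicity come from the form of the radical as an intersection;
  idempotence holds because a radical is semiprime, hence its own radical.\<close>

lemma radical_closure_operator: "closure_operator (ideal_lattice n \<mu>) (nary_radical n \<mu>)"
proof -
  interpret complete_lattice "ideal_lattice n \<mu>" by (rule ideal_complete_lattice)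
  have "isotone (ideal_lattice n \<mu>) (ideal_lattice n \<mu>) (nary_radical n \<mu>)"
    using weak_partial_order_axioms
    by (intro isotoneI) (auto simp: ideal_lattice_def nary_radical_def)
  then show ?thesis
    using radical_ideal radical_of_semiprime[OF radical_semiprime]
    by (auto simp: closure_operator_def idempotent_def ideal_lattice_def nary_radical_def)
qed

end

theorem corollary4p12:
  fixes n :: nat
    and \<mu> :: "'t::comm_monoid_add list \<Rightarrow> 'g::semigroup_add list \<Rightarrow> 't"
  assumes "n \<ge> 3"
    and "nary_gamma_semiring n \<mu>"
  shows "(\<forall>Q. nary_ideal n \<mu> Q \<longrightarrow> (nary_semiprime n \<mu> Q \<longleftrightarrow> Q = nary_radical n \<mu> Q)) \<and>
    lattice (ideal_lattice n \<mu>) \<and>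
    closure_operator (ideal_lattice n \<mu>) (nary_radical n \<mu>)"
proof -
  interpret nary_gamma_semiring_ge3 n \<mu>
    using assms by (simp add: nary_gamma_semiring_ge3_def nary_gamma_semiring_ge3_axioms_def)
  interpret L: complete_lattice "ideal_lattice n \<mu>" by (rule ideal_complete_lattice)
  show ?thesis
    using radical_of_semiprime radical_semiprime radical_closure_operator L.lattice_axioms by metis
qed

end
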